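(* Let $a\in\mathbb{R}$ and $L>0$. Consider the problem $$u''' + a u' + u u' = 0 \ \text{ on } [0,L], \qquad u(0)=u(L)=u'(L)=0. \qquad ( * )$$ If $aL^2\neq 4\pi^2$, then there exists a unique nontrivial solution $u$ of $( * )$ with fundamental period $L$. If $aL^2=4\pi^2$, then there is no nontrivial solution of $( * )$ with fundamental period $L$.
   Context: Solutions are real-valued functions $u\in C^3[0,L]$; nontrivial means not identically zero. Any solution of $( * )$ is infinitely smooth and periodic with period $L$, i.e. it extends to an $L$-periodic $C^\infty$ function on $\mathbb{R}$. The fundamental period of a nontrivial periodic function is its minimal positive period; the fundamental period of a solution on $[0,L]$ means that of its $L$-periodic extension to $\mathbb{R}$. *)

theory Defs
  imports "HOL-Analysis.Analysis" "HOL-Library.FuncSet" "HOL-Library.Periodic_Fun"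
    "HOL-Library.Real_Mod"
begin

text \<open>
  Differentiability is taken relative to the interval \<open>[0, L]\<close>, hence one-sided at the end
  points. For \<open>L > 0\<close> the functions \<open>u1\<close>, \<open>u2\<close>, \<open>u3\<close> are uniquely determined on \<open>[0, L]\<close>.
\<close>

definition kdv_solution :: "real \<Rightarrow> real \<Rightarrow> (real \<Rightarrow> real) \<Rightarrow> bool" where
  "kdv_solution a L u \<longleftrightarrow>
     (\<exists>u1 u2 u3.
        (\<forall>x\<in>{0..L}. (u has_real_derivative u1 x) (at x within {0..L})) \<and>
        (\<forall>x\<in>{0..L}. (u1 has_real_derivative u2 x) (at x within {0..L})) \<and>
        (\<forall>x\<in>{0..L}. (u2 has_real_derivative u3 x) (at x within {0..L})) \<and>
        continuous_on {0..L} u3 \<and>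
        (\<forall>x\<in>{0..L}. u3 x + a * u1 x + u x * u1 x = 0) \<and>
        u 0 = 0 \<and> u L = 0 \<and> u1 L = 0)"

definition nontrivial_on :: "real set \<Rightarrow> (real \<Rightarrow> real) \<Rightarrow> bool" where
  "nontrivial_on S u \<longleftrightarrow> (\<exists>x\<in>S. u x \<noteq> 0)"

definition periodic_extension :: "real \<Rightarrow> (real \<Rightarrow> real) \<Rightarrow> real \<Rightarrow> real" where
  "periodic_extension L u = (\<lambda>x. u (x rmod L))"

text \<open>The next lemma needs \<open>u 0 = u L\<close>, which holds for all solutions.\<close>

lemma periodic_extension_eq:
  assumes "u 0 = u L" "x \<in> {0..L}"
  shows "periodic_extension L u x = u x"
proof (cases "x = L")
  case True
  have "L rmod L = 0"
    by (cases "L = 0") (auto intro: rmod_unique[where n = 1])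
  then show ?thesis
    unfolding periodic_extension_def True by (simp only: assms(1))
next
  case False
  then have "x \<in> {0..<\<bar>L\<bar>}"
    using assms(2) by simp
  then have "x rmod L = x"
    by (rule rmod_unique[where n = 0]) simp
  then show ?thesis
    by (simp only: periodic_extension_def)
qed

definition has_fundamental_period :: "(real \<Rightarrow> real) \<Rightarrow> real \<Rightarrow> bool" where
  "has_fundamental_period f p \<longleftrightarrow>
     p > 0 \<and> periodic_fun_simple f p \<and> (\<forall>q>0. periodic_fun_simple f q \<longrightarrow> p \<le> q)"

text \<open>
  A function on \<open>[0, L]\<close> is represented by an element of \<open>extensional {0..L}\<close>, so that two
  functions are equal iff they agree on \<open>[0, L]\<close>.
\<close>

definition nontrivial_solutions :: "real \<Rightarrow> real \<Rightarrow> (real \<Rightarrow> real) set" where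
  "nontrivial_solutions a L =
     {u \<in> extensional {0..L}. kdv_solution a L u \<and> nontrivial_on {0..L} u}"

end

theory Submission
  imports Defs
begin

text \<open>
  Testing the equation with \<open>u\<close> and using the boundary values gives \<open>u'(0) = 0\<close>. With this
  third initial condition, two integrations of the equation yield, for one constant \<open>C\<close>,
  \<open>u'' = C - a u - u\<^sup>2/2\<close> and \<open>u'\<^sup>2 = 2 C u - a u\<^sup>2 - u\<^sup>3/3\<close>
  (lemma \<open>kdv_first_integrals\<close>).
  Let \<open>p \<noteq> 0\<close> be the extreme value of \<open>u\<close> that has the sign of \<open>C\<close>, which is
  nonzero when \<open>u\<close> is nontrivial. Since \<open>u'\<close> vanishes there,
  \<open>6 C = p (p + 3 a)\<close>, and the second identity becomes
  \<open>u'\<^sup>2 = u (p - u) (u + p + 3 a) / 3\<close>. The substitution \<open>u = p sin\<^sup>2 \<theta>\<close> removes the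
  square-root singularities at the two turning points \<open>0\<close> and \<open>p\<close> and leaves
  \<open>\<theta>' = sqrt ((3 a + p (1 + sin\<^sup>2 \<theta>)) / 12)\<close> with \<open>\<theta>(0) = 0\<close>,
  an autonomous equation with positive right-hand side as soon as \<open>3 a + p > 0\<close> and
  \<open>3 a + 2 p > 0\<close>. These inequalities do hold for a nontrivial solution, so by uniqueness for the
  second-order equation it is the wave with amplitude \<open>p\<close> (lemma \<open>kdv_solution_imp_wave\<close>).
  Conversely every such wave solves the problem on any interval whose right end is one of its
  zeros (lemma \<open>kdv_solution_wave\<close>).

  The wave has fundamental period
  \<open>T(p) = \<integral>\<^sub>0\<^sup>\<pi> d\<theta> / sqrt ((3 a + p (1 + sin\<^sup>2 \<theta>)) / 12)\<close>.
  So the solutions with fundamental period \<open>L\<close> correspond to the admissible amplitudes \<open>p \<noteq> 0\<close> with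
  \<open>T(p) = L\<close>. The function \<open>T\<close> is continuous and strictly decreasing in \<open>p\<close>; it tends to \<open>0\<close> at
  infinity and to infinity at the lower end of the admissible range, where the radicand acquires a
  double zero or vanishes identically. Hence exactly one admissible \<open>p\<close> satisfies \<open>T(p) = L\<close>,
  and the only way to lose the solution is \<open>p = 0\<close>. That amplitude is admissible for \<open>a > 0\<close> only, with
  \<open>T(0) = 2\<pi> / sqrt a\<close>, the period of the linearised equation; and \<open>T(0) = L\<close> says
  \<open>a L\<^sup>2 = 4\<pi>\<^sup>2\<close>.
\<close>

section \<open>Calculus and periodicity on an interval\<close>

lemma fundamental_period_unique:
  "has_fundamental_period f p \<Longrightarrow> has_fundamental_period f q \<Longrightarrow> p = q"
  unfolding has_fundamental_period_def by (meson order_antisym)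

lemma periodic_extension_unique:
  assumes "0 < L" "periodic_fun_simple v L" "\<And>x. x \<in> {0..L} \<Longrightarrow> u x = v x"
  shows "periodic_extension L u = v"
proof
  fix x
  interpret periodic_fun_simple v L by fact
  have "x rmod L \<in> {0..L}"
    using assms(1) by (simp add: rmod_nonneg rmod_le)
  then have "periodic_extension L u x = v (x rmod L)"
    by (simp add: periodic_extension_def assms(3))
  also have "\<dots> = v x"
    using minus_of_int[of x "\<lfloor>x / \<bar>L\<bar>\<rfloor>"] assms(1) by (simp add: rmod_def mult.commute)
  finally show "periodic_extension L u x = v x" .
qed

text \<open>
  A Gronwall argument for \<open>w'' = k w\<close>: the quantity \<open>E = w\<^sup>2 + w'\<^sup>2\<close> satisfies
  \<open>\<bar>E'\<bar> \<le> (1 + K) E\<close> with \<open>K\<close> a bound for \<open>\<bar>k\<bar>\<close>, so it cannot leave the value \<open>0\<close> in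
  either direction. The base point \<open>c\<close> is arbitrary because the lemma is applied both at the left end
  and at an interior critical point.
\<close>

lemma linear_ode_zero_data_imp_zero:
  fixes w w1 k :: "real \<Rightarrow> real"
  assumes w: "\<And>x. x \<in> {0..L} \<Longrightarrow> (w has_real_derivative w1 x) (at x within {0..L})"
    and w1: "\<And>x. x \<in> {0..L} \<Longrightarrow> (w1 has_real_derivative k x * w x) (at x within {0..L})"
    and k: "continuous_on {0..L} k"
    and c: "c \<in> {0..L}" "w c = 0" "w1 c = 0" and x: "x \<in> {0..L}"
  shows "w x = 0"
proof -
  obtain K where K: "\<forall>y\<in>{0..L}. \<bar>k y\<bar> \<le> K"
    using compact_imp_bounded[OF compact_continuous_image[OF k compact_Icc]]
    by (auto simp: bounded_iff)
  define E where "E = (\<lambda>y. (w y)\<^sup>2 + (w1 y)\<^sup>2)"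
  define E' where "E' = (\<lambda>y. 2 * (1 + k y) * (w y * w1 y))"
  have dE: "(E has_real_derivative E' y) (at y within {0..L})" if "y \<in> {0..L}" for y
    unfolding E_def E'_def using w[OF that] w1[OF that]
    by (auto intro!: derivative_eq_intros simp: algebra_simps)
  have E'_le: "\<bar>E' y\<bar> \<le> (1 + K) * E y" if "y \<in> {0..L}" for y
  proof -
    have "0 \<le> (\<bar>w y\<bar> - \<bar>w1 y\<bar>)\<^sup>2" by simp
    then have "2 * \<bar>w y * w1 y\<bar> \<le> E y"
      by (simp add: E_def power2_diff abs_mult)
    moreover have "\<bar>1 + k y\<bar> \<le> 1 + K" using bspec[OF K that] by linarith
    ultimately have "\<bar>1 + k y\<bar> * (2 * \<bar>w y * w1 y\<bar>) \<le> (1 + K) * E y"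
      by (intro mult_mono) auto
    then show ?thesis by (simp only: E'_def abs_mult abs_numeral mult_ac)
  qed
  have dF: "((\<lambda>y. E y * exp (b * y)) has_real_derivative (E' y + b * E y) * exp (b * y))
      (at y within {0..L})" if "y \<in> {0..L}" for b y
    using dE[OF that] by (auto intro!: derivative_eq_intros simp: algebra_simps)
  have cont: "continuous_on S (\<lambda>y. E y * exp (b * y))" if "S \<subseteq> {0..L}" for b S
    by (rule continuous_on_subset[OF DERIV_continuous_on[OF dF] that])
  have "E x \<le> 0"
  proof (cases "c \<le> x")
    case True
    have "E c * exp (- (1 + K) * c) \<ge> E x * exp (- (1 + K) * x)"
    proof (rule DERIV_nonpos_imp_decreasing_open[OF True])
      fix y assume y: "c < y" "y < x"
      then have at: "at y within {0..L} = at y" and y: "y \<in> {0..L}"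
        using c(1) x by (auto intro!: at_within_Icc_at)
      have "E' y + - (1 + K) * E y \<le> 0"
        using abs_le_D1[OF E'_le[OF y]] by (simp add: algebra_simps)
      then show "\<exists>d. ((\<lambda>y. E y * exp (- (1 + K) * y)) has_real_derivative d) (at y) \<and> d \<le> 0"
        using dF[OF y, of "- (1 + K)"] unfolding at
        by (meson exp_ge_zero mult_nonpos_nonneg)
    qed (use c(1) x in \<open>auto intro!: cont\<close>)
    then show ?thesis using c by (simp add: E_def mult_le_0_iff)
  next
    case False
    then have "x \<le> c" by simp
    then have "E x * exp ((1 + K) * x) \<le> E c * exp ((1 + K) * c)"
    proof (rule DERIV_nonneg_imp_increasing_open)
      fix y assume y: "x < y" "y < c"
      then have at: "at y within {0..L} = at y" and y: "y \<in> {0..L}"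
        using c(1) x by (auto intro!: at_within_Icc_at)
      have "0 \<le> E' y + (1 + K) * E y"
        using abs_le_D2[OF E'_le[OF y]] by (simp add: algebra_simps)
      then show "\<exists>d. ((\<lambda>y. E y * exp ((1 + K) * y)) has_real_derivative d) (at y) \<and> 0 \<le> d"
        using dF[OF y, of "1 + K"] unfolding at
        by (meson exp_ge_zero mult_nonneg_nonneg)
    qed (use c(1) x in \<open>auto intro!: cont\<close>)
    then show ?thesis using c by (simp add: E_def mult_le_0_iff)
  qed
  then show "w x = 0"
    by (simp add: E_def add_nonneg_eq_0_iff sum_power2_le_zero_iff)
qed

lemma increases_right_of_strict_minimum:
  fixes f f1 :: "real \<Rightarrow> real"
  assumes f: "\<And>x. x \<in> {0..L} \<Longrightarrow> (f has_real_derivative f1 x) (at x within {0..L})"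
    and f1: "(f1 has_real_derivative d) (at c within {0..L})"
    and c: "0 \<le> c" "c < L" "f1 c = 0" "0 < d"
  shows "\<exists>x\<in>{c..L}. f c < f x"
proof -
  obtain e where e: "0 < e" "\<And>h. 0 < h \<Longrightarrow> c + h \<in> {0..L} \<Longrightarrow> h < e \<Longrightarrow> f1 c < f1 (c + h)"
    using has_real_derivative_pos_inc_right[OF f1 c(4)] by blast
  define h where "h = min (e / 2) (L - c)"
  have h: "0 < h" "h < e" "c + h \<le> L"
    using e(1) c by (auto simp: h_def)
  have "f c < f (c + h)"
  proof (rule DERIV_pos_imp_increasing_open[where f = f])
    fix y assume y: "c < y" "y < c + h"
    then have "at y within {0..L} = at y" "y \<in> {0..L}"
      using c h by (auto intro!: at_within_Icc_at)
    moreover have "0 < f1 y" using e(2)[of "y - c"] y c h by simp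
    ultimately show "\<exists>d. (f has_real_derivative d) (at y) \<and> 0 < d" using f by metis
  next
    have "continuous_on {0..L} f" by (rule DERIV_continuous_on[OF f])
    then show "continuous_on {c..c + h} f"
      by (rule continuous_on_subset) (use c h in auto)
  qed (use h in auto)
  then show ?thesis using h by (intro bexI[of _ "c + h"]) auto
qed

text \<open>
  The maximum over the compact interval is positive because \<open>f\<close> starts with zero slope and positive
  curvature, and therefore it is not attained at the end points, where \<open>f\<close> vanishes.
\<close>

lemma interior_positive_maximum:
  fixes f f1 f2 :: "real \<Rightarrow> real"
  assumes "0 < L"
    and f: "\<And>x. x \<in> {0..L} \<Longrightarrow> (f has_real_derivative f1 x) (at x within {0..L})"
    and f1: "\<And>x. x \<in> {0..L} \<Longrightarrow> (f1 has_real_derivative f2 x) (at x within {0..L})"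
    and bc: "f 0 = 0" "f L = 0" "f1 0 = 0" "0 < f2 0"
  shows "\<exists>m\<in>{0..L}. 0 < f m \<and> f1 m = 0 \<and> f2 m \<le> 0"
proof -
  have "continuous_on {0..L} f" by (rule DERIV_continuous_on[OF f])
  then obtain m where m: "m \<in> {0..L}" "\<And>x. x \<in> {0..L} \<Longrightarrow> f x \<le> f m"
    using continuous_attains_sup[of "{0..L}" f] assms(1) by auto
  obtain x where x: "x \<in> {0..L}" "f 0 < f x"
    using increases_right_of_strict_minimum[OF f f1[of 0]] assms(1) bc by auto
  have pos: "0 < f m" using m(2)[OF x(1)] x(2) bc(1) by simp
  then have int: "0 < m" "m < L"
    using bc m(1) by (auto simp: less_le)
  have "(f has_real_derivative f1 m) (at m)"
    using f[OF m(1)] int by (simp add: at_within_Icc_at)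
  then have f1m: "f1 m = 0"
    by (rule DERIV_local_max[where d = "min m (L - m)"]) (use int m(2) in \<open>auto simp: abs_less_iff\<close>)
  have "f2 m \<le> 0"
  proof (rule ccontr)
    assume "\<not> f2 m \<le> 0"
    then obtain x where "x \<in> {m..L}" "f m < f x"
      using increases_right_of_strict_minimum[OF f f1[OF m(1)]] int f1m by auto
    then show False using m(2)[of x] int by auto
  qed
  then show ?thesis using m(1) pos f1m by blast
qed

section \<open>The wave profiles\<close>

text \<open>
  Positivity of the two extreme values, at \<open>sin\<^sup>2 \<theta> = 0\<close> and \<open>sin\<^sup>2 \<theta> = 1\<close>, of the
  radicand \<open>3 a + p (1 + sin\<^sup>2 \<theta>)\<close>.
\<close>

definition admissible :: "real \<Rightarrow> real \<Rightarrow> bool" where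
  "admissible a p \<longleftrightarrow> 0 < 3 * a + p \<and> 0 < 3 * a + 2 * p"

definition phase_speed :: "real \<Rightarrow> real \<Rightarrow> real \<Rightarrow> real" where
  "phase_speed a p s = sqrt ((3 * a + p * (1 + (sin s)\<^sup>2)) / 12)"

text \<open>
  The instant at which the phase reaches the value \<open>s\<close>. It is defined on the whole line, so that
  its inverse \<open>phase\<close> is a global solution of the phase equation.
\<close>

definition arrival_time :: "real \<Rightarrow> real \<Rightarrow> real \<Rightarrow> real" where
  "arrival_time a p s = (LBINT r=0..s. 1 / phase_speed a p r)"

definition wave_period :: "real \<Rightarrow> real \<Rightarrow> real" where
  "wave_period a p = arrival_time a p pi"

definition phase :: "real \<Rightarrow> real \<Rightarrow> real \<Rightarrow> real" where
  "phase a p = inv (arrival_time a p)"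

definition wave :: "real \<Rightarrow> real \<Rightarrow> real \<Rightarrow> real" where
  "wave a p x = p * (sin (phase a p x))\<^sup>2"

lemma admissible_radicand_pos:
  assumes "admissible a p"
  shows "0 < 3 * a + p * (1 + (sin s)\<^sup>2)"
proof -
  define y where "y = (sin s)\<^sup>2"
  have y: "0 \<le> y" "y \<le> 1"
    by (simp_all add: y_def power2_le_iff_abs_le abs_square_le_1)
  have "3 * a + p * (1 + y) = (1 - y) * (3 * a + p) + y * (3 * a + 2 * p)"
    by (simp add: algebra_simps)
  also have "\<dots> > 0"
  proof (cases "y = 0")
    case True
    then show ?thesis using assms by (simp add: admissible_def)
  next
    case False
    then have "0 < y * (3 * a + 2 * p)" "0 \<le> (1 - y) * (3 * a + p)"
      using y assms by (simp_all add: admissible_def)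
    then show ?thesis by linarith
  qed
  finally show ?thesis by (simp add: y_def)
qed

lemma phase_speed_pos: "admissible a p \<Longrightarrow> 0 < phase_speed a p s"
  using admissible_radicand_pos by (simp add: phase_speed_def)

text \<open>
  A bound on the speed is a positive lower bound on the slope of \<open>arrival_time\<close>, which makes that
  function surjective.
\<close>

lemma phase_speed_le:
  assumes "admissible a p"
  shows "phase_speed a p s \<le> sqrt ((3 * \<bar>a\<bar> + 2 * \<bar>p\<bar>) / 12)"
proof -
  have "p * (1 + (sin s)\<^sup>2) \<le> \<bar>p\<bar> * 2"
    using abs_square_le_1[of "sin s"] by (intro mult_mono) auto
  then show ?thesis
    unfolding phase_speed_def by (intro real_sqrt_le_mono divide_right_mono) auto
qed

lemma phase_speed_plus_pi: "phase_speed a p (s + pi) = phase_speed a p s"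
  by (simp add: phase_speed_def)

lemma continuous_on_inverse_phase_speed:
  assumes "admissible a p"
  shows "continuous_on S (\<lambda>r. 1 / phase_speed a p r)"
proof -
  have "phase_speed a p r \<noteq> 0" for r
    using phase_speed_pos[OF assms, of r] by simp
  moreover have "continuous_on S (phase_speed a p)"
    unfolding phase_speed_def by (intro continuous_intros) auto
  ultimately show ?thesis
    by (intro continuous_intros) auto
qed

lemma arrival_time_0 [simp]: "arrival_time a p 0 = 0"
  by (simp add: arrival_time_def zero_ereal_def)

lemma arrival_time_has_derivative:
  assumes "admissible a p"
  shows "(arrival_time a p has_real_derivative 1 / phase_speed a p s) (at s)"
proof -
  let ?l = "- \<bar>s\<bar> - 1" and ?r = "\<bar>s\<bar> + 1"
  have "((\<lambda>u. LBINT r=ereal 0..ereal u. 1 / phase_speed a p r) has_vector_derivative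
          1 / phase_speed a p s) (at s within {?l..?r})"
    by (rule interval_integral_FTC2)
       (use continuous_on_inverse_phase_speed[OF assms] in auto)
  moreover have "at s within {?l..?r} = at s"
    by (rule at_within_interior) (simp add: interior_cbox; linarith)
  ultimately show ?thesis
    by (simp add: arrival_time_def[abs_def] has_real_derivative_iff_has_vector_derivative
        zero_ereal_def)
qed

lemma arrival_time_strict_mono:
  assumes "admissible a p"
  shows "strict_mono (arrival_time a p)"
proof (rule strict_monoI)
  fix x y :: real assume "x < y"
  then show "arrival_time a p x < arrival_time a p y"
    by (rule DERIV_pos_imp_increasing)
       (metis arrival_time_has_derivative assms phase_speed_pos zero_less_divide_1_iff)
qed

lemma arrival_time_surj:
  assumes "admissible a p"
  shows "surj (arrival_time a p)"
proof -
  define M where "M = sqrt ((3 * \<bar>a\<bar> + 2 * \<bar>p\<bar>) / 12)"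
  have M: "0 < M"
    using less_le_trans[OF phase_speed_pos[OF assms] phase_speed_le[OF assms]] by (simp only: M_def)
  have lower: "1 / M \<le> 1 / phase_speed a p s" for s
    using phase_speed_pos[OF assms, of s] phase_speed_le[OF assms, of s, folded M_def] M
    by (intro divide_left_mono) auto
  have mono: "arrival_time a p x - x / M \<le> arrival_time a p y - y / M" if "x \<le> y" for x y
    using that
    by (rule DERIV_nonneg_imp_nondecreasing)
       (use M lower in \<open>auto intro!: exI derivative_eq_intros arrival_time_has_derivative[OF assms]\<close>)
  have "\<exists>x. arrival_time a p x = y" for y
  proof -
    have "isCont (arrival_time a p) x" for x
      using arrival_time_has_derivative[OF assms] DERIV_isCont by blast
    then have "\<exists>x\<ge>- M * \<bar>y\<bar>. x \<le> M * \<bar>y\<bar> \<and> arrival_time a p x = y"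
      using mono[of 0 "M * \<bar>y\<bar>"] mono[of "- M * \<bar>y\<bar>" 0] M
      by (intro IVT) auto
    then show ?thesis by blast
  qed
  then show ?thesis by (metis surjI)
qed

lemma arrival_time_phase: "admissible a p \<Longrightarrow> arrival_time a p (phase a p x) = x"
  unfolding phase_def by (simp add: arrival_time_surj surj_f_inv_f)

lemma phase_arrival_time: "admissible a p \<Longrightarrow> phase a p (arrival_time a p s) = s"
  unfolding phase_def
  by (simp add: arrival_time_strict_mono strict_mono_imp_inj_on)

lemma phase_0: "admissible a p \<Longrightarrow> phase a p 0 = 0"
  using phase_arrival_time[of a p 0] by simp

lemma phase_strict_mono:
  assumes "admissible a p"
  shows "strict_mono (phase a p)"
  using arrival_time_strict_mono[OF assms] arrival_time_phase[OF assms]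
  by (metis strict_monoI strict_mono_less)

lemma wave_period_pos:
  assumes "admissible a p"
  shows "0 < wave_period a p"
  using strict_monoD[OF arrival_time_strict_mono[OF assms], of 0 pi]
  by (simp add: wave_period_def)

lemma phase_has_derivative:
  assumes "admissible a p"
  shows "(phase a p has_real_derivative phase_speed a p (phase a p x)) (at x)"
proof -
  have "(phase a p has_real_derivative inverse (1 / phase_speed a p (phase a p x)))
          (at (arrival_time a p (phase a p x)))"
    unfolding has_field_derivative_def
  proof (rule has_derivative_inverse_strong[where S = UNIV and f = "arrival_time a p"
        and f' = "(*) (1 / phase_speed a p (phase a p x))"])
    show "continuous_on UNIV (arrival_time a p)"
      using arrival_time_has_derivative[OF assms] DERIV_isCont
      by (blast intro: continuous_at_imp_continuous_on)
    show "(arrival_time a p has_derivative (*) (1 / phase_speed a p (phase a p x)))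
            (at (phase a p x))"
      using arrival_time_has_derivative[OF assms] by (simp only: has_field_derivative_def)
  qed (use assms phase_speed_pos[OF assms, of "phase a p x"] in
        \<open>auto simp: phase_arrival_time fun_eq_iff\<close>)
  then show ?thesis
    by (simp add: arrival_time_phase assms)
qed

text \<open>
  The speed has period \<open>\<pi>\<close>, so each half turn of the phase takes the same time.
\<close>

lemma arrival_time_plus_pi:
  assumes "admissible a p"
  shows "arrival_time a p (s + pi) = arrival_time a p s + wave_period a p"
proof -
  have "((\<lambda>s. arrival_time a p (s + pi) - arrival_time a p s) has_real_derivative 0) (at s)" for s
    using arrival_time_has_derivative[OF assms]
    by (auto intro!: derivative_eq_intros DERIV_shift[THEN iffD1] simp: phase_speed_plus_pi)
  then have "arrival_time a p (s + pi) - arrival_time a p s =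
             arrival_time a p (0 + pi) - arrival_time a p 0"
    using DERIV_isconst_all by blast
  then show ?thesis by (simp add: wave_period_def)
qed

lemma phase_plus_wave_period:
  assumes "admissible a p"
  shows "phase a p (x + wave_period a p) = phase a p x + pi"
  using arrival_time_plus_pi[OF assms, of "phase a p x"]
  by (metis arrival_time_phase assms phase_arrival_time)

lemma wave_plus_period:
  assumes "admissible a p"
  shows "wave a p (x + wave_period a p) = wave a p x"
  by (simp add: wave_def phase_plus_wave_period[OF assms])


section \<open>The period as a function of the amplitude\<close>

lemma wave_period_strict_antimono:
  assumes "admissible a p" "p < q"
  shows "wave_period a q < wave_period a p"
proof -
  have q: "admissible a q"
    using assms by (simp add: admissible_def)
  let ?D = "\<lambda>s. arrival_time a p s - arrival_time a q s"
  have "?D 0 < ?D pi"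
  proof (rule DERIV_pos_imp_increasing[OF pi_gt_zero])
    fix s :: real
    have "p * (1 + (sin s)\<^sup>2) < q * (1 + (sin s)\<^sup>2)"
      using assms by (intro mult_strict_right_mono) (auto intro: add_pos_nonneg)
    then have "phase_speed a p s < phase_speed a q s"
      by (simp add: phase_speed_def)
    then have "1 / phase_speed a q s < 1 / phase_speed a p s"
      using phase_speed_pos[OF assms(1)] by (intro divide_strict_left_mono) (auto intro: mult_pos_pos phase_speed_pos q)
    then show "\<exists>y. (?D has_real_derivative y) (at s) \<and> 0 < y"
      by (auto intro!: exI derivative_eq_intros arrival_time_has_derivative assms q)
  qed
  then show ?thesis by (simp add: wave_period_def)
qed

lemma wave_period_inj:
  assumes "admissible a p" "admissible a q" "wave_period a p = wave_period a q"
  shows "p = q"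
  using assms wave_period_strict_antimono by (metis linorder_less_linear order_less_irrefl)

text \<open>
  With a fixed domain of integration, continuity in the amplitude reduces to continuity of the
  integrand in both variables.
\<close>

lemma wave_period_eq_integral:
  assumes "admissible a p"
  shows "wave_period a p = integral {0..pi} (\<lambda>r. 1 / phase_speed a p r)"
proof -
  have "((\<lambda>r. 1 / phase_speed a p r) has_integral arrival_time a p pi - arrival_time a p 0) {0..pi}"
    using arrival_time_has_derivative[OF assms]
    by (intro fundamental_theorem_of_calculus)
       (auto simp: has_real_derivative_iff_has_vector_derivative[symmetric] intro: has_field_derivative_at_within)
  then show ?thesis by (simp add: wave_period_def integral_unique)
qed

lemma continuous_on_wave_period: "continuous_on {p. admissible a p} (wave_period a)"
proof -
  have "continuous_on ({p. admissible a p} \<times> cbox 0 pi) (\<lambda>(p, r). 1 / phase_speed a p r)"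
  proof -
    have "sqrt ((3 * a + p * (1 + (sin r)\<^sup>2)) / 12) \<noteq> 0" if "admissible a p" for p r
      using phase_speed_pos[OF that, of r] by (simp add: phase_speed_def)
    then show ?thesis
      unfolding phase_speed_def case_prod_unfold
      by (intro continuous_intros) auto
  qed
  then have "continuous_on {p. admissible a p} (\<lambda>p. integral (cbox 0 pi) (\<lambda>r. 1 / phase_speed a p r))"
    by (rule integral_continuous_on_param)
  then show ?thesis
    by (rule continuous_on_eq) (simp add: wave_period_eq_integral)
qed

lemma wave_period_0:
  assumes "0 < a"
  shows "wave_period a 0 = 2 * pi / sqrt a"
proof -
  have adm: "admissible a 0" using assms by (simp add: admissible_def)
  have "1 / phase_speed a 0 r = 2 / sqrt a" for r
    by (simp add: phase_speed_def real_sqrt_divide)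
  then show ?thesis
    by (simp only: wave_period_eq_integral[OF adm]) simp
qed

lemma wave_period_le:
  assumes "0 \<le> p" "0 < 3 * a + p"
  shows "wave_period a p \<le> pi / sqrt ((3 * a + p) / 12)"
proof -
  have adm: "admissible a p" using assms by (simp add: admissible_def)
  define m where "m = sqrt ((3 * a + p) / 12)"
  have m: "0 < m" "m \<le> phase_speed a p s" for s
    using assms by (simp_all add: m_def phase_speed_def algebra_simps)
  have "0 / m - arrival_time a p 0 \<le> pi / m - arrival_time a p pi"
  proof (rule DERIV_nonneg_imp_nondecreasing[OF pi_ge_zero])
    fix s :: real
    have "1 / phase_speed a p s \<le> 1 / m"
      using m by (intro divide_left_mono) (auto intro: mult_pos_pos phase_speed_pos adm)
    then show "\<exists>y. ((\<lambda>s. s / m - arrival_time a p s) has_real_derivative y) (at s) \<and> 0 \<le> y"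
      using m by (auto intro!: exI derivative_eq_intros arrival_time_has_derivative adm)
  qed
  then show ?thesis by (simp add: wave_period_def m_def)
qed

text \<open>
  The period blows up logarithmically when the radicand nearly has a double zero at \<open>c\<close>: the
  hypothesis gives \<open>phase_speed \<le> sqrt (M / 12) (r + (s - c))\<close> for \<open>s \<ge> c\<close>, so crossing
  \<open>[c, c + 1]\<close> alone takes at least
  \<open>sqrt (12 / M) (ln (r + 1) - ln r)\<close>.
\<close>

lemma wave_period_ge_ln:
  assumes adm: "admissible a p" and c: "0 \<le> c" "c + 1 \<le> pi" and M: "0 < M" and r: "0 < r"
    and bound: "\<And>s. 3 * a + p * (1 + (sin s)\<^sup>2) \<le> M * (r\<^sup>2 + (s - c)\<^sup>2)"
  shows "sqrt (12 / M) * ln (1 / r) \<le> wave_period a p"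
proof -
  let ?G = "\<lambda>s. arrival_time a p s - sqrt (12 / M) * ln (r + (s - c))"
  have "?G c \<le> ?G (c + 1)"
  proof (rule DERIV_nonneg_imp_nondecreasing[where f = ?G])
    fix s assume s: "c \<le> s" "s \<le> c + 1"
    have pos: "0 < r + (s - c)" using s r by simp
    have "r\<^sup>2 + (s - c)\<^sup>2 \<le> (r + (s - c))\<^sup>2"
      using s r by (simp add: power2_sum)
    then have "3 * a + p * (1 + (sin s)\<^sup>2) \<le> M * (r + (s - c))\<^sup>2"
      using bound[of s] M by (meson mult_left_mono order_trans less_imp_le)
    then have "phase_speed a p s \<le> sqrt (M * (r + (s - c))\<^sup>2 / 12)"
      unfolding phase_speed_def by (intro real_sqrt_le_mono divide_right_mono) auto
    also have "\<dots> = sqrt (M / 12) * (r + (s - c))"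
      using pos by (simp add: real_sqrt_mult real_sqrt_divide)
    finally have "1 / (sqrt (M / 12) * (r + (s - c))) \<le> 1 / phase_speed a p s"
      using pos M by (intro divide_left_mono) (auto intro!: mult_pos_pos phase_speed_pos adm)
    then have "sqrt (12 / M) * (1 / (r + (s - c))) \<le> 1 / phase_speed a p s"
      by (simp add: real_sqrt_divide)
    then show "\<exists>y. (?G has_real_derivative y) (at s) \<and> 0 \<le> y"
      using pos by (auto intro!: exI derivative_eq_intros arrival_time_has_derivative adm)
  qed simp
  moreover have "arrival_time a p 0 \<le> arrival_time a p c" "arrival_time a p (c + 1) \<le> arrival_time a p pi"
    using c by (simp_all only: strict_mono_less_eq[OF arrival_time_strict_mono[OF adm]])
  moreover have "sqrt (12 / M) * 0 \<le> sqrt (12 / M) * ln (r + 1)"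
    using r M by (intro mult_left_mono) auto
  ultimately show ?thesis
    using r by (simp add: wave_period_def ln_div)
qed

text \<open>
  At the lower end of the admissible range the radicand degenerates: for \<open>a \<le> 0\<close> the end is
  \<open>p = - 3 a\<close>, with a zero at phase \<open>0\<close>; for \<open>a > 0\<close> it is \<open>p = - 3 a / 2\<close>, with a zero at
  phase \<open>\<pi> / 2\<close>. In both cases the amplitude is chosen such that the radicand equals \<open>r\<^sup>2\<close>
  at that phase, with \<open>r\<close> small enough for the logarithmic bound to reach \<open>K\<close>.
\<close>

lemma wave_period_unbounded:
  "\<exists>p. admissible a p \<and> K \<le> wave_period a p"
proof -
  \<comment> \<open>A bound for \<open>\<bar>p\<bar>\<close> in both cases below.\<close>
  define M where "M = 3 * \<bar>a\<bar> + 1"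
  define r where "r = exp (- (\<bar>K\<bar> * sqrt (M / 12)))"
  have M: "1 \<le> M" by (simp add: M_def)
  have r: "0 < r" "r \<le> 1" by (simp_all add: r_def M_def)
  have r2: "0 < r\<^sup>2" "r\<^sup>2 \<le> 1" using r by (simp_all add: power_le_one)
  have rM: "r\<^sup>2 \<le> M * r\<^sup>2"
    using M r2 by (simp add: mult_le_cancel_right1)
  have "sqrt (12 / M) * ln (1 / r) = \<bar>K\<bar> * (sqrt (12 / M) * sqrt (M / 12))"
    by (simp add: r_def ln_div)
  also have "sqrt (12 / M) * sqrt (M / 12) = 1"
    using M by (simp flip: real_sqrt_mult)
  finally have K: "K \<le> sqrt (12 / M) * ln (1 / r)" by simp
  show ?thesis
  proof (cases "a \<le> 0")
    case True
    define p where "p = r\<^sup>2 - 3 * a"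
    have adm: "admissible a p"
      using True r2(1) unfolding admissible_def p_def by (simp only: algebra_simps) linarith
    have p: "0 \<le> p" "p \<le> M"
      using True r2(2) order_less_imp_le[OF r2(1)] unfolding p_def M_def by linarith+
    have "3 * a + p * (1 + (sin s)\<^sup>2) \<le> M * (r\<^sup>2 + (s - 0)\<^sup>2)" for s
    proof -
      have "(sin s)\<^sup>2 \<le> s\<^sup>2"
        using abs_sin_x_le_abs_x by (simp add: abs_le_square_iff)
      then have "p * (sin s)\<^sup>2 \<le> M * s\<^sup>2"
        using p M by (intro mult_mono) auto
      then show ?thesis using rM by (simp add: p_def algebra_simps)
    qed
    then have "sqrt (12 / M) * ln (1 / r) \<le> wave_period a p"
      using M r pi_gt3 by (intro wave_period_ge_ln[OF adm, of 0]) auto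
    then show ?thesis using K adm by (meson order_trans)
  next
    case False
    define p where "p = (r\<^sup>2 - 3 * a) / 2"
    have "3 * a + p = (3 * a + r\<^sup>2) / 2" "3 * a + 2 * p = r\<^sup>2"
      by (simp_all add: p_def field_simps)
    moreover have "0 < (3 * a + r\<^sup>2) / 2"
      using add_pos_pos[OF _ r2(1), of "3 * a"] False by simp
    ultimately have adm: "admissible a p"
      using r2(1) by (simp only: admissible_def)
    have "\<bar>(e - 3 * a) / 2\<bar> \<le> 3 * \<bar>a\<bar> + 1" if "0 \<le> e" "e \<le> 1" for e
      using that False by (simp add: abs_le_iff)
    then have p: "\<bar>p\<bar> \<le> M"
      using r2 by (simp add: p_def M_def)
    have "3 * a + p * (1 + (sin s)\<^sup>2) \<le> M * (r\<^sup>2 + (s - pi / 2)\<^sup>2)" for s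
    proof -
      have "(cos s)\<^sup>2 \<le> (s - pi / 2)\<^sup>2"
        using abs_sin_x_le_abs_x[of "s - pi / 2"]
        by (simp add: abs_le_square_iff sin_diff)
      then have "\<bar>p\<bar> * (cos s)\<^sup>2 \<le> M * (s - pi / 2)\<^sup>2"
        using p M by (intro mult_mono) auto
      moreover have "- p * (cos s)\<^sup>2 \<le> \<bar>p\<bar> * (cos s)\<^sup>2"
        by (intro mult_right_mono) auto
      moreover have "3 * a + p * (1 + (sin s)\<^sup>2) = r\<^sup>2 - p * (cos s)\<^sup>2"
        by (simp add: p_def sin_squared_eq field_simps)
      ultimately show ?thesis using rM by (simp add: algebra_simps)
    qed
    then have "sqrt (12 / M) * ln (1 / r) \<le> wave_period a p"
      using M r pi_gt3 by (intro wave_period_ge_ln[OF adm, of "pi / 2"]) auto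
    then show ?thesis using K adm by (meson order_trans)
  qed
qed

text \<open>
  Intermediate value theorem: \<open>wave_period_unbounded\<close> provides a period above \<open>L\<close>, and
  \<open>wave_period_le\<close> one below \<open>L\<close> for large amplitudes. The admissible amplitudes form an
  up-closed set, so the interval between the two is admissible.
\<close>

lemma wave_period_surj:
  assumes "0 < L"
  shows "\<exists>p. admissible a p \<and> wave_period a p = L"
proof -
  obtain p where p: "admissible a p" "L \<le> wave_period a p"
    using wave_period_unbounded by blast
  \<comment> \<open>Chosen to turn the bound \<open>pi / sqrt ((3 * a + q) / 12)\<close> into at most \<open>L\<close>.\<close>
  define q where "q = 12 * pi\<^sup>2 / L\<^sup>2 + 3 * \<bar>a\<bar>"
  have q: "0 \<le> q" "12 * pi\<^sup>2 / L\<^sup>2 \<le> 3 * a + q" "0 < 12 * pi\<^sup>2 / L\<^sup>2"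
    using assms by (simp_all add: q_def)
  then have qadm: "admissible a q" by (simp add: admissible_def)
  have "pi / L = sqrt ((12 * pi\<^sup>2 / L\<^sup>2) / 12)"
    using assms by (simp add: real_sqrt_divide)
  also have "\<dots> \<le> sqrt ((3 * a + q) / 12)"
    using q by (intro real_sqrt_le_mono divide_right_mono) auto
  finally have "pi / sqrt ((3 * a + q) / 12) \<le> pi / (pi / L)"
    using less_le_trans[OF q(3,2)] assms
    by (intro divide_left_mono mult_pos_pos) auto
  moreover have "wave_period a q \<le> pi / sqrt ((3 * a + q) / 12)"
    using q by (intro wave_period_le) auto
  ultimately have qL: "wave_period a q \<le> L" by simp
  have "p \<le> q"
    using wave_period_strict_antimono[OF qadm, of p] p(2) qL by linarith
  have sub: "{p..q} \<subseteq> {p. admissible a p}"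
    using p(1) by (auto simp: admissible_def)
  then have "\<exists>x\<ge>p. x \<le> q \<and> wave_period a x = L"
    using p qL \<open>p \<le> q\<close> continuous_on_subset[OF continuous_on_wave_period sub]
    by (intro IVT2') auto
  then show ?thesis using sub by auto
qed


section \<open>The waves solve the equation\<close>

definition wave' :: "real \<Rightarrow> real \<Rightarrow> real \<Rightarrow> real" where
  "wave' a p x = 2 * p * sin (phase a p x) * cos (phase a p x) * phase_speed a p (phase a p x)"

text \<open>
  The second derivative, written by the first integral with \<open>C = p (p + 3 a) / 6\<close>. In this form
  its own derivative is the equation to be solved.
\<close>

definition wave'' :: "real \<Rightarrow> real \<Rightarrow> real \<Rightarrow> real" where
  "wave'' a p x = p * (p + 3 * a) / 6 - a * wave a p x - (wave a p x)\<^sup>2 / 2"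

lemma phase_speed_squared:
  assumes "admissible a p"
  shows "(phase_speed a p s)\<^sup>2 = (3 * a + p * (1 + (sin s)\<^sup>2)) / 12"
  using admissible_radicand_pos[OF assms, of s] by (simp add: phase_speed_def)

lemma phase_speed_has_derivative:
  assumes "admissible a p"
  shows "(phase_speed a p has_real_derivative p * sin s * cos s / (12 * phase_speed a p s)) (at s)"
  unfolding phase_speed_def[abs_def] using admissible_radicand_pos[OF assms, of s]
  by (auto intro!: derivative_eq_intros simp: field_simps)

lemma wave_has_derivative:
  assumes "admissible a p"
  shows "(wave a p has_real_derivative wave' a p x) (at x)"
  unfolding wave_def[abs_def] wave'_def
  by (auto intro!: derivative_eq_intros phase_has_derivative assms)

text \<open>
  The only computation behind the waves. With \<open>R = \<theta>'\<close> one has \<open>12 R\<^sup>2 = 3 a + p (1 + sin\<^sup>2 \<theta>)\<close>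
  and \<open>R' = p sin \<theta> cos \<theta> / 12\<close>; eliminating \<open>R\<close> and \<open>cos \<theta>\<close> leaves a polynomial in
  \<open>sin\<^sup>2 \<theta>\<close>.
\<close>

lemma wave'_has_derivative:
  assumes "admissible a p"
  shows "(wave' a p has_real_derivative wave'' a p x) (at x)"
proof -
  let ?s = "phase a p x"
  define S C R where "S = sin ?s" and "C = cos ?s" and "R = phase_speed a p ?s"
  have R: "0 < R" "12 * R\<^sup>2 = 3 * a + p * (1 + S\<^sup>2)"
    using phase_speed_pos[OF assms] phase_speed_squared[OF assms, of ?s]
    by (simp_all add: R_def S_def)
  have C: "C\<^sup>2 = 1 - S\<^sup>2" by (simp add: C_def S_def cos_squared_eq)
  have "(wave' a p has_real_derivative
      2 * p * ((C * C - S * S) * R * R + S * C * (p * S * C / (12 * R) * R))) (at x)"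
    unfolding wave'_def[abs_def] S_def C_def R_def
    by (rule derivative_eq_intros refl phase_has_derivative assms
        DERIV_chain2[OF phase_speed_has_derivative])+
       (simp add: algebra_simps)
  also have "2 * p * ((C * C - S * S) * R * R + S * C * (p * S * C / (12 * R) * R)) =
      p * ((C\<^sup>2 - S\<^sup>2) * (12 * R\<^sup>2) + p * S\<^sup>2 * C\<^sup>2) / 6"
    using R(1) by (simp add: field_simps power2_eq_square)
  also have "\<dots> = p * (p + 3 * a) / 6 - a * (p * S\<^sup>2) - (p * S\<^sup>2)\<^sup>2 / 2"
    unfolding R(2) C by (simp add: field_simps power2_eq_square)
  finally show ?thesis by (simp add: wave''_def wave_def S_def)
qed

lemma wave''_has_derivative:
  assumes "admissible a p"
  shows "(wave'' a p has_real_derivative - a * wave' a p x - wave a p x * wave' a p x) (at x)"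
  unfolding wave''_def[abs_def]
  by (auto intro!: derivative_eq_intros wave_has_derivative assms)

lemma wave_initial:
  assumes "admissible a p"
  shows "wave a p 0 = 0" "wave' a p 0 = 0"
  using assms by (simp_all add: wave_def wave'_def phase_0)

text \<open>
  The zeros are the instants at which the phase is a multiple of \<open>\<pi>\<close>. Thus they are the multiples
  of \<open>wave_period a p\<close>, which rules out smaller positive periods.
\<close>

lemma wave_eq_0_iff:
  assumes "admissible a p" "p \<noteq> 0"
  shows "wave a p x = 0 \<longleftrightarrow> (\<exists>k::int. x = of_int k * wave_period a p)"
proof -
  have per: "phase a p (of_int k * wave_period a p) = of_int k * pi" for k
  proof -
    interpret periodic_fun_simple "\<lambda>x. phase a p x - x / wave_period a p * pi" "wave_period a p"
      using wave_period_pos[OF assms(1)]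
      by unfold_locales (simp add: phase_plus_wave_period[OF assms(1)] field_simps)
    show ?thesis
      using plus_of_int[of 0 k] wave_period_pos[OF assms(1)] by (simp add: phase_0 assms)
  qed
  have "wave a p x = 0 \<longleftrightarrow> (\<exists>k::int. phase a p x = of_int k * pi)"
    using assms(2) by (simp add: wave_def sin_zero_iff_int2)
  also have "\<dots> \<longleftrightarrow> (\<exists>k::int. x = of_int k * wave_period a p)"
    by (simp flip: per add: strict_mono_eq[OF phase_strict_mono[OF assms(1)]])
  finally show ?thesis .
qed

lemma wave_has_fundamental_period:
  assumes "admissible a p" "p \<noteq> 0"
  shows "has_fundamental_period (wave a p) (wave_period a p)"
proof -
  have "periodic_fun_simple (wave a p) (wave_period a p)"
    by unfold_locales (rule wave_plus_period[OF assms(1)])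
  moreover have "wave_period a p \<le> q" if "0 < q" "periodic_fun_simple (wave a p) q" for q
  proof -
    have "wave a p (0 + q) = wave a p 0"
      using that(2) by (rule periodic_fun_simple.plus_period)
    then obtain k :: int where k: "q = of_int k * wave_period a p"
      using wave_eq_0_iff[OF assms] wave_initial[OF assms(1)] by auto
    then have "1 \<le> k"
      using that(1) wave_period_pos[OF assms(1)] by (simp add: zero_less_mult_iff)
    then have "1 * wave_period a p \<le> of_int k * wave_period a p"
      using wave_period_pos[OF assms(1)] by (intro mult_right_mono) auto
    then show ?thesis by (simp add: k)
  qed
  ultimately show ?thesis
    using wave_period_pos[OF assms(1)] by (simp add: has_fundamental_period_def)
qed

text \<open>
  At a zero of a wave its slope vanishes as well, so a single condition at \<open>L\<close> gives both boundary
  values there.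
\<close>

lemma kdv_solution_wave:
  assumes "admissible a p" "p \<noteq> 0" "0 < L" "wave a p L = 0"
    and "\<And>x. x \<in> {0..L} \<Longrightarrow> u x = wave a p x"
  shows "kdv_solution a L u"
proof -
  let ?w3 = "\<lambda>x. - a * wave' a p x - wave a p x * wave' a p x"
  have end': "wave' a p L = 0"
    using assms(2,4) by (simp add: wave_def wave'_def)
  have du: "(u has_real_derivative wave' a p x) (at x within {0..L})" if "x \<in> {0..L}" for x
    using has_field_derivative_at_within[OF wave_has_derivative[OF assms(1)], of x "{0..L}"]
    by (rule has_field_derivative_transform_within[where d = 1]) (use that assms(5) in auto)
  have cont: "continuous_on {0..L} ?w3"
    by (intro continuous_intros continuous_at_imp_continuous_on ballI)
       (use wave_has_derivative[OF assms(1)] wave'_has_derivative[OF assms(1)] DERIV_isCont in blast)+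
  show ?thesis
    unfolding kdv_solution_def
    by (rule exI[of _ "wave' a p"], rule exI[of _ "wave'' a p"], rule exI[of _ ?w3])
       (use du cont end' assms wave_initial[OF assms(1)]
            has_field_derivative_at_within[OF wave'_has_derivative[OF assms(1)]]
            has_field_derivative_at_within[OF wave''_has_derivative[OF assms(1)]] in auto)
qed

section \<open>Every solution is a wave\<close>

text \<open>
  The difference of two solutions satisfies the linear equation
  \<open>w'' = - (a + (u + v) / 2) w\<close>.
\<close>

lemma same_initial_data_imp_eq:
  fixes u v :: "real \<Rightarrow> real"
  assumes u: "\<And>x. x \<in> {0..L} \<Longrightarrow> (u has_real_derivative u1 x) (at x within {0..L})"
      "\<And>x. x \<in> {0..L} \<Longrightarrow> (u1 has_real_derivative C - a * u x - (u x)\<^sup>2 / 2) (at x within {0..L})"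
    and v: "\<And>x. x \<in> {0..L} \<Longrightarrow> (v has_real_derivative v1 x) (at x within {0..L})"
      "\<And>x. x \<in> {0..L} \<Longrightarrow> (v1 has_real_derivative C - a * v x - (v x)\<^sup>2 / 2) (at x within {0..L})"
    and c: "c \<in> {0..L}" "u c = v c" "u1 c = v1 c" and x: "x \<in> {0..L}"
  shows "u x = v x"
proof -
  have "u x - v x = 0"
  proof (rule linear_ode_zero_data_imp_zero[where w = "\<lambda>x. u x - v x" and ?w1.0 = "\<lambda>x. u1 x - v1 x"
        and k = "\<lambda>x. - a - (u x + v x) / 2" and c = c and L = L])
    fix x assume x: "x \<in> {0..L}"
    show "((\<lambda>x. u x - v x) has_real_derivative u1 x - v1 x) (at x within {0..L})"
      using u(1)[OF x] v(1)[OF x] by (rule DERIV_diff)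
    show "((\<lambda>x. u1 x - v1 x) has_real_derivative (- a - (u x + v x) / 2) * (u x - v x))
        (at x within {0..L})"
      using DERIV_diff[OF u(2)[OF x] v(2)[OF x]]
      by (rule DERIV_cong) (simp add: field_simps power2_eq_square)
  next
    show "continuous_on {0..L} (\<lambda>x. - a - (u x + v x) / 2)"
      by (intro continuous_intros DERIV_continuous_on[OF u(1)] DERIV_continuous_on[OF v(1)]) auto
  qed (use c x in auto)
  then show ?thesis by simp
qed

text \<open>
  The slope at \<open>0\<close> comes from the identity obtained by multiplying the equation by \<open>u\<close>: the function
  \<open>H\<close> below is constant, and its values at the end points are \<open>- u'(0)\<^sup>2 / 2\<close> and \<open>0\<close>.
\<close>

lemma kdv_first_integrals:
  assumes "0 < L" "kdv_solution a L u"
  shows "\<exists>u1 C. u 0 = 0 \<and> u L = 0 \<and> u1 0 = 0 \<and>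
    (\<forall>x\<in>{0..L}. (u has_real_derivative u1 x) (at x within {0..L})) \<and>
    (\<forall>x\<in>{0..L}. (u1 has_real_derivative C - a * u x - (u x)\<^sup>2 / 2) (at x within {0..L})) \<and>
    (\<forall>x\<in>{0..L}. (u1 x)\<^sup>2 = 2 * C * u x - a * (u x)\<^sup>2 - (u x)^3 / 3)"
proof -
  have const: "f x = f y" if "\<And>x. x \<in> {0..L} \<Longrightarrow> (f has_real_derivative 0) (at x within {0..L})"
    "x \<in> {0..L}" "y \<in> {0..L}" for f x y
    using has_field_derivative_zero_constant[of "{0..L}" f] that by (metis convex_real_interval(5))
  obtain u1 u2 u3 where
    u: "\<And>x. x \<in> {0..L} \<Longrightarrow> (u has_real_derivative u1 x) (at x within {0..L})"
    and u1: "\<And>x. x \<in> {0..L} \<Longrightarrow> (u1 has_real_derivative u2 x) (at x within {0..L})"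
    and u2: "\<And>x. x \<in> {0..L} \<Longrightarrow> (u2 has_real_derivative u3 x) (at x within {0..L})"
    and ode: "\<And>x. x \<in> {0..L} \<Longrightarrow> u3 x + a * u1 x + u x * u1 x = 0"
    and bc: "u 0 = 0" "u L = 0" "u1 L = 0"
    using assms(2) unfolding kdv_solution_def by blast
  have u3: "u3 x = - a * u1 x - u x * u1 x" if "x \<in> {0..L}" for x
    using ode[OF that] by linarith
  define H where "H = (\<lambda>x. u x * u2 x - (u1 x)\<^sup>2 / 2 + a * (u x)\<^sup>2 / 2 + (u x)^3 / 3)"
  have "H 0 = H L"
  proof (rule const[where f = H])
    fix x assume x: "x \<in> {0..L}"
    have "(H has_real_derivative u x * u3 x + a * (u x * u1 x) + u x * u x * u1 x) (at x within {0..L})"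
      unfolding H_def
      by (auto intro!: derivative_eq_intros u[OF x] u1[OF x] u2[OF x] simp: power2_eq_square)
    then show "(H has_real_derivative 0) (at x within {0..L})"
      by (rule DERIV_cong) (simp add: u3[OF x] algebra_simps)
  qed (use assms(1) in auto)
  then have u10: "u1 0 = 0" by (simp add: H_def bc)
  define C where "C = u2 0"
  have "u2 x + a * u x + (u x)\<^sup>2 / 2 = u2 0 + a * u 0 + (u 0)\<^sup>2 / 2" if "x \<in> {0..L}" for x
  proof (rule const[OF _ that, where f = "\<lambda>x. u2 x + a * u x + (u x)\<^sup>2 / 2"])
    fix x assume x: "x \<in> {0..L}"
    show "((\<lambda>x. u2 x + a * u x + (u x)\<^sup>2 / 2) has_real_derivative 0) (at x within {0..L})"
      by (auto intro!: derivative_eq_intros u[OF x] u1[OF x] u2[OF x]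
          simp: u3[OF x] algebra_simps)
  qed (use assms(1) in auto)
  then have u2C: "u2 x = C - a * u x - (u x)\<^sup>2 / 2" if "x \<in> {0..L}" for x
    using that bc by (simp add: C_def algebra_simps)
  have "(u1 x)\<^sup>2 - 2 * C * u x + a * (u x)\<^sup>2 + (u x)^3 / 3 =
        (u1 0)\<^sup>2 - 2 * C * u 0 + a * (u 0)\<^sup>2 + (u 0)^3 / 3" if "x \<in> {0..L}" for x
  proof (rule const[OF _ that, where f = "\<lambda>x. (u1 x)\<^sup>2 - 2 * C * u x + a * (u x)\<^sup>2 + (u x)^3 / 3"])
    fix x assume x: "x \<in> {0..L}"
    show "((\<lambda>x. (u1 x)\<^sup>2 - 2 * C * u x + a * (u x)\<^sup>2 + (u x)^3 / 3) has_real_derivative 0)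
        (at x within {0..L})"
      by (auto intro!: derivative_eq_intros u[OF x] u1[OF x] u2[OF x]
          simp: u2C[OF x] algebra_simps power2_eq_square)
  qed (use assms(1) in auto)
  then have "(u1 x)\<^sup>2 = 2 * C * u x - a * (u x)\<^sup>2 - (u x)^3 / 3" if "x \<in> {0..L}" for x
    using that bc u10 by (simp add: algebra_simps)
  moreover have "(u1 has_real_derivative C - a * u x - (u x)\<^sup>2 / 2) (at x within {0..L})"
    if "x \<in> {0..L}" for x
    using u1[OF that] u2C[OF that] by simp
  ultimately show ?thesis
    using bc u u10 by (intro exI[of _ u1] exI[of _ C]) auto
qed

text \<open>
  The constant \<open>C = u''(0)\<close> is nonzero, since otherwise \<open>u\<close> has the initial data of the zero
  solution. Multiplication by \<open>C\<close> lets one maximum principle treat both signs of \<open>C\<close>; the value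
  \<open>p\<close> of \<open>u\<close> at the maximum of \<open>C u\<close> is the amplitude.
\<close>

lemma kdv_solution_imp_wave:
  assumes "0 < L" "kdv_solution a L u" "nontrivial_on {0..L} u"
  shows "\<exists>p. admissible a p \<and> p \<noteq> 0 \<and> wave a p L = 0 \<and> (\<forall>x\<in>{0..L}. u x = wave a p x)"
proof -
  obtain u1 C where bc: "u 0 = 0" "u L = 0" "u1 0 = 0"
    and u: "\<And>x. x \<in> {0..L} \<Longrightarrow> (u has_real_derivative u1 x) (at x within {0..L})"
    and u1: "\<And>x. x \<in> {0..L} \<Longrightarrow>
      (u1 has_real_derivative C - a * u x - (u x)\<^sup>2 / 2) (at x within {0..L})"
    and energy: "\<And>x. x \<in> {0..L} \<Longrightarrow> (u1 x)\<^sup>2 = 2 * C * u x - a * (u x)\<^sup>2 - (u x)^3 / 3"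
    using kdv_first_integrals[OF assms(1,2)] by blast
  have "C \<noteq> 0"
  proof
    assume "C = 0"
    have "u x = 0" if "x \<in> {0..L}" for x
    proof (rule same_initial_data_imp_eq[where u = u and ?u1.0 = u1 and C = C and a = a and L = L and v = "\<lambda>_. 0" and ?v1.0 = "\<lambda>_. 0" and c = 0])
      show "((\<lambda>_. 0) has_real_derivative C - a * 0 - 0\<^sup>2 / 2) (at y within {0..L})" for y
        using \<open>C = 0\<close> by simp
    qed (use u u1 that bc assms(1) in simp_all)
    then show False using assms(3) by (auto simp: nontrivial_on_def)
  qed
  have "\<exists>m\<in>{0..L}. 0 < C * u m \<and> C * u1 m = 0 \<and> C * (C - a * u m - (u m)\<^sup>2 / 2) \<le> 0"
  proof (rule interior_positive_maximum[OF assms(1), where f = "\<lambda>x. C * u x" and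
        ?f1.0 = "\<lambda>x. C * u1 x" and ?f2.0 = "\<lambda>x. C * (C - a * u x - (u x)\<^sup>2 / 2)"])
    show "0 < C * (C - a * u 0 - (u 0)\<^sup>2 / 2)"
      using bc \<open>C \<noteq> 0\<close> by (simp flip: power2_eq_square)
  qed (rule DERIV_cmult u u1 | assumption | use bc in simp)+
  then obtain m where m: "m \<in> {0..L}" "0 < C * u m" "u1 m = 0"
      "C * (C - a * u m - (u m)\<^sup>2 / 2) \<le> 0"
    using \<open>C \<noteq> 0\<close> by auto
  define p where "p = u m"
  have p: "p \<noteq> 0" using m(2) by (auto simp: p_def)
  have "p * (6 * C - p * (p + 3 * a)) = 0"
    using energy[OF m(1)] m(3) by (simp add: p_def field_simps power2_eq_square power3_eq_cube)
  then have C: "C = p * (p + 3 * a) / 6" using p by simp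
  \<comment> \<open>Positivity of \<open>C u\<close> gives the first admissibility condition, and the sign of its second
    derivative at the maximum gives the second one up to equality.\<close>
  have "0 < p\<^sup>2 * (p + 3 * a)"
    using m(2) by (simp add: C flip: p_def) (simp add: power2_eq_square mult_ac)
  then have pos1: "0 < p + 3 * a" using p by (simp add: zero_less_mult_iff)
  have "C * (C - a * p - p\<^sup>2 / 2) = - (p\<^sup>2 * (p + 3 * a) * (2 * p + 3 * a)) / 36"
    by (simp add: C field_simps power2_eq_square)
  then have "0 \<le> 2 * p + 3 * a"
    using m(4) \<open>0 < p\<^sup>2 * (p + 3 * a)\<close> by (simp add: p_def[symmetric] zero_le_mult_iff)
  \<comment> \<open>In the case of equality \<open>p\<close> is an equilibrium, which \<open>u\<close> cannot reach at the finite time \<open>m\<close>.\<close>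
  moreover have "2 * p + 3 * a \<noteq> 0"
  proof
    assume eq: "2 * p + 3 * a = 0"
    have "C - a * p - p\<^sup>2 / 2 = - p * (2 * p + 3 * a) / 6"
      by (simp add: C field_simps power2_eq_square)
    then have "C - a * p - p\<^sup>2 / 2 = 0"
      using eq by simp
    then have const: "((\<lambda>_. 0) has_real_derivative C - a * p - p\<^sup>2 / 2) (at y within {0..L})" for y
      by (simp only: DERIV_const)
    have "u 0 = p"
      by (rule same_initial_data_imp_eq[where u = u and ?u1.0 = u1 and C = C and a = a and L = L and v = "\<lambda>_. p" and ?v1.0 = "\<lambda>_. 0" and c = m])
         (use u u1 const m(1,3) assms(1) in \<open>simp_all add: p_def\<close>)
    then show False using bc p by simp
  qed
  ultimately have adm: "admissible a p" using pos1 by (simp add: admissible_def)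
  have eq: "u x = wave a p x" if "x \<in> {0..L}" for x
  proof (rule same_initial_data_imp_eq[where u = u and ?u1.0 = u1 and C = C and a = a and L = L and v = "wave a p" and ?v1.0 = "wave' a p" and c = 0])
    fix y
    show "(wave a p has_real_derivative wave' a p y) (at y within {0..L})"
      by (rule has_field_derivative_at_within[OF wave_has_derivative[OF adm]])
    show "(wave' a p has_real_derivative C - a * wave a p y - (wave a p y)\<^sup>2 / 2)
        (at y within {0..L})"
      using has_field_derivative_at_within[OF wave'_has_derivative[OF adm]]
      by (simp only: C wave''_def)
  qed (use u u1 that bc assms(1) wave_initial[OF adm] in simp_all)
  then show ?thesis using adm p bc assms(1) by (intro exI[of _ p]) auto
qed

section \<open>Counting the solutions\<close>

lemma periodic_extension_eq_wave:
  assumes adm: "admissible a p" "p \<noteq> 0" and "0 < L" and wL: "wave a p L = 0"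
    and eq: "\<And>x. x \<in> {0..L} \<Longrightarrow> u x = wave a p x"
  shows "periodic_extension L u = wave a p"
proof (rule periodic_extension_unique[OF \<open>0 < L\<close> _ eq])
  interpret periodic_fun_simple "wave a p" "wave_period a p"
    by unfold_locales (rule wave_plus_period[OF adm(1)])
  obtain k :: int where "L = of_int k * wave_period a p"
    using wL wave_eq_0_iff[OF adm] by blast
  then show "periodic_fun_simple (wave a p) L"
    by unfold_locales (simp add: plus_of_int)
qed

text \<open>
  A nontrivial solution is a wave whose period may divide \<open>L\<close> properly. Requiring \<open>L\<close> to be the
  fundamental period singles out the waves that complete exactly one oscillation.
\<close>

lemma solution_with_fundamental_period_iff:
  assumes "0 < L"
  shows "u \<in> nontrivial_solutions a L \<and> has_fundamental_period (periodic_extension L u) L \<longleftrightarrow>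
    (\<exists>p. admissible a p \<and> p \<noteq> 0 \<and> wave_period a p = L \<and> u = restrict (wave a p) {0..L})"
    (is "?sol \<longleftrightarrow> ?wave")
proof
  assume ?sol
  then have u: "u \<in> extensional {0..L}" "kdv_solution a L u" "nontrivial_on {0..L} u"
    and fund: "has_fundamental_period (periodic_extension L u) L"
    by (simp_all add: nontrivial_solutions_def)
  obtain p where p: "admissible a p" "p \<noteq> 0" "wave a p L = 0"
    and eq: "\<And>x. x \<in> {0..L} \<Longrightarrow> u x = wave a p x"
    using kdv_solution_imp_wave[OF assms u(2,3)] by blast
  have "wave_period a p = L"
    using fund periodic_extension_eq_wave[OF p(1,2) assms p(3) eq]
      wave_has_fundamental_period[OF p(1,2)] fundamental_period_unique by metis
  moreover have "u = restrict (wave a p) {0..L}"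
    using u(1) eq by (intro extensionalityI[of _ "{0..L}"]) auto
  ultimately show ?wave using p by blast
next
  assume ?wave
  then obtain p where p: "admissible a p" "p \<noteq> 0" "wave_period a p = L"
    and u: "u = restrict (wave a p) {0..L}" by blast
  have wL: "wave a p L = 0"
    using wave_plus_period[OF p(1), of 0] wave_initial[OF p(1)] p(3) by simp
  have eq: "\<And>x. x \<in> {0..L} \<Longrightarrow> u x = wave a p x" by (simp add: u)
  \<comment> \<open>Half a period is no multiple of the period, hence not a zero of the wave.\<close>
  have "wave a p (L / 2) \<noteq> 0"
  proof
    assume "wave a p (L / 2) = 0"
    then obtain k :: int where "L / 2 = of_int k * L"
      using wave_eq_0_iff[OF p(1,2)] p(3) by auto
    then have "of_int (2 * k) = (1::real)" using assms by simp
    then have "2 * k = 1" by (simp only: of_int_eq_1_iff)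
    then show False by presburger
  qed
  then have "nontrivial_on {0..L} u"
    using assms by (auto simp: nontrivial_on_def u intro!: bexI[of _ "L / 2"])
  then show ?sol
    using kdv_solution_wave[OF p(1,2) assms wL eq] periodic_extension_eq_wave[OF p(1,2) assms wL eq]
      wave_has_fundamental_period[OF p(1,2)] p(3)
    by (simp add: nontrivial_solutions_def) (simp add: u)
qed

lemma wave_period_0_iff:
  assumes "0 < L"
  shows "admissible a 0 \<and> wave_period a 0 = L \<longleftrightarrow> a * L\<^sup>2 = 4 * pi\<^sup>2"
proof (cases "0 < a")
  case True
  have "2 * pi / sqrt a = L \<longleftrightarrow> 2 * pi = L * sqrt a"
    using True by (auto simp: field_simps)
  also have "\<dots> \<longleftrightarrow> (2 * pi)\<^sup>2 = (L * sqrt a)\<^sup>2"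
    using True assms by (intro power2_eq_iff_nonneg[symmetric]) auto
  also have "\<dots> \<longleftrightarrow> a * L\<^sup>2 = 4 * pi\<^sup>2"
    using True by (auto simp: power_mult_distrib mult.commute)
  finally show ?thesis using True by (simp add: wave_period_0 admissible_def)
next
  case False
  then have "a * L\<^sup>2 \<le> 0" by (simp add: mult_le_0_iff)
  moreover have "0 < 4 * pi\<^sup>2" by simp
  ultimately have "a * L\<^sup>2 \<noteq> 4 * pi\<^sup>2" by linarith
  then show ?thesis using False by (simp add: admissible_def)
qed

theorem theorem1:
  fixes a L :: real
  assumes "L > 0"
  shows "(a * L\<^sup>2 \<noteq> 4 * pi\<^sup>2 \<longrightarrow>
            (\<exists>!u. u \<in> nontrivial_solutions a L \<and>
                  has_fundamental_period (periodic_extension L u) L)) \<and>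
         (a * L\<^sup>2 = 4 * pi\<^sup>2 \<longrightarrow>
            \<not> (\<exists>u. u \<in> nontrivial_solutions a L \<and>
                  has_fundamental_period (periodic_extension L u) L))"
proof -
  obtain p where p: "admissible a p" "wave_period a p = L"
    using wave_period_surj[OF assms] by blast
  have unique: "q = p" if "admissible a q" "wave_period a q = L" for q
    using wave_period_inj[OF that(1) p(1)] that(2) p(2) by simp
  have "p = 0 \<longleftrightarrow> a * L\<^sup>2 = 4 * pi\<^sup>2"
    using p unique[of 0] wave_period_0_iff[OF assms] by auto
  then show ?thesis
    unfolding solution_with_fundamental_period_iff[OF assms] using p unique by blast
qed

end
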